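(* Let $(V,\tau)$ be a (real, Hausdorff) topological vector space, not necessarily complete and not necessarily locally convex. Every closed quadratic form $q:V\to[0,\infty]$ is lower semicontinuous with respect to $\tau$, i.e., for every net $(u_i)$ in $V$ and every $u\in V$ with $u_i\to u$ with respect to $\tau$ one has $q(u)\le\liminf_i q(u_i)$.
   Context: A quadratic form on a real vector space $V$ is a map $q:V\to[0,\infty]$ with $2q(u)+2q(v)=q(u+v)+q(u-v)$ and $q(\lambda u)=|\lambda|^2q(u)$ for all $u,v\in V$, $\lambda\in\mathbb R$ (convention $0\cdot\infty=0$). Its domain is $D(q)=\{u\in V: q(u)<\infty\}$, and $\|u\|_q=\sqrt{q(u)}$ is a seminorm on $D(q)$. The form topology $\tau_q$ on $D(q)$ is the smallest topology containing both the subspace topology of $\tau$ and the topology generated by $\|\cdot\|_q$. The form $q$ is called closed (with respect to $\tau$) if the topological vector space $(D(q),\tau_q)$ is complete, i.e., every Cauchy net converges. Topological vector spaces are assumed Hausdorff. *)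

theory Defs
  imports "HOL-Analysis.Analysis"
begin

section \<open>Nets\<close>

definition directed_set :: "'i set \<Rightarrow> ('i \<times> 'i) set \<Rightarrow> bool" where
  "directed_set I r \<longleftrightarrow>
     I \<noteq> {} \<and> preorder_on I r \<and> (\<forall>i\<in>I. \<forall>j\<in>I. \<exists>k\<in>I. (i, k) \<in> r \<and> (j, k) \<in> r)"

text \<open>
  The pair \<^term>\<open>(i, j) \<in> r\<close> reads ``\<^term>\<open>j\<close> is at least \<^term>\<open>i\<close>''. The filter below is generated
  by the tails of the directed set, so that the library notions \<^const>\<open>limitin\<close> and
  \<^const>\<open>Liminf\<close> become convergence and limit inferior along a net.
\<close>

definition net_filter :: "'i set \<Rightarrow> ('i \<times> 'i) set \<Rightarrow> 'i filter" where
  "net_filter I r = (INF k\<in>I. principal (r `` {k}))"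

lemma eventually_net_filter:
  assumes "directed_set I r"
  shows "eventually P (net_filter I r) \<longleftrightarrow> (\<exists>k\<in>I. \<forall>j. (k, j) \<in> r \<longrightarrow> P j)"
proof -
  have I: "I \<noteq> {}" and r: "trans r"
    and d: "\<And>i j. i \<in> I \<Longrightarrow> j \<in> I \<Longrightarrow> \<exists>k\<in>I. (i, k) \<in> r \<and> (j, k) \<in> r"
    using assms by (auto simp: directed_set_def preorder_on_def)
  show ?thesis
    unfolding net_filter_def
  proof (subst eventually_INF_base)
    fix a b assume "a \<in> I" "b \<in> I"
    with d obtain k where "k \<in> I" "(a, k) \<in> r" "(b, k) \<in> r" by blast
    then show "\<exists>x\<in>I. principal (r `` {x}) \<le> inf (principal (r `` {a})) (principal (r `` {b}))"
      using r by (intro bexI[of _ k]) (auto dest: transD)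
  qed (use I in \<open>auto simp: eventually_principal\<close>)
qed

lemma Liminf_net_filter:
  fixes f :: "'i \<Rightarrow> 'b :: complete_lattice"
  assumes "directed_set I r"
  shows "Liminf (net_filter I r) f = (SUP k\<in>I. INF j\<in>r `` {k}. f j)"
proof (rule antisym)
  show "Liminf (net_filter I r) f \<le> (SUP k\<in>I. INF j\<in>r `` {k}. f j)"
    unfolding Liminf_def
  proof (rule SUP_least)
    fix P assume "P \<in> {P. eventually P (net_filter I r)}"
    then obtain k where "k \<in> I" "\<forall>j. (k, j) \<in> r \<longrightarrow> P j"
      using eventually_net_filter[OF assms] by auto
    then show "Inf (f ` Collect P) \<le> (SUP k\<in>I. INF j\<in>r `` {k}. f j)"
      by (intro SUP_upper2[of k]) (auto intro!: INF_superset_mono)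
  qed
  show "(SUP k\<in>I. INF j\<in>r `` {k}. f j) \<le> Liminf (net_filter I r) f"
  proof (rule SUP_least)
    fix k assume "k \<in> I"
    then have "eventually (\<lambda>j. j \<in> r `` {k}) (net_filter I r)"
      using eventually_net_filter[OF assms] by auto
    then show "(INF j\<in>r `` {k}. f j) \<le> Liminf (net_filter I r) f"
      unfolding Liminf_def by (intro SUP_upper2[of "\<lambda>j. j \<in> r `` {k}"]) (auto intro!: INF_superset_mono)
  qed
qed


section \<open>Topological vector spaces and completeness\<close>

definition real_tvs :: "'a :: real_vector topology \<Rightarrow> bool" where
  "real_tvs T \<longleftrightarrow>
     topspace T = UNIV \<and> Hausdorff_space T \<and>
     continuous_map (prod_topology T T) T (\<lambda>(u, v). u + v) \<and>
     continuous_map (prod_topology euclideanreal T) T (\<lambda>(c, u). c *\<^sub>R u)"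

text \<open>
  The next two definitions are meant for a vector topology \<^term>\<open>X\<close> on a linear subspace
  \<^term>\<open>topspace X\<close> of the ambient type.
\<close>

definition Cauchy_net ::
  "'a :: real_vector topology \<Rightarrow> 'i set \<Rightarrow> ('i \<times> 'i) set \<Rightarrow> ('i \<Rightarrow> 'a) \<Rightarrow> bool" where
  "Cauchy_net X I r u \<longleftrightarrow>
     u ` I \<subseteq> topspace X \<and>
     (\<forall>U. openin X U \<and> 0 \<in> U \<longrightarrow>
        (\<exists>k\<in>I. \<forall>i j. (k, i) \<in> r \<and> (k, j) \<in> r \<longrightarrow> u i - u j \<in> U))"

text \<open>
  A definition cannot quantify over index types, so the index sets here are the subsets of the
  type \<^typ>\<open>'a set \<times> 'a\<close>. By the lemma \<open>net_complete_Cauchy_net\<close> below, this already gives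
  convergence of all Cauchy nets, over any index type.
\<close>

definition net_complete :: "'a :: real_vector topology \<Rightarrow> bool" where
  "net_complete X \<longleftrightarrow>
     (\<forall>(I :: ('a set \<times> 'a) set) r u. directed_set I r \<and> Cauchy_net X I r u \<longrightarrow>
        (\<exists>l. limitin X u l (net_filter I r)))"

lemma net_complete_Cauchy_net:
  fixes X :: "'a :: real_vector topology" and I :: "'i set"
  assumes X: "net_complete X" and I: "directed_set I r" and u: "Cauchy_net X I r u"
  shows "\<exists>l. limitin X u l (net_filter I r)"
proof -
  define A where "A k = u ` (r `` {k})" for k
  define J where "J = {(A k, y) | k y. k \<in> I \<and> y \<in> A k}"
  define s where "s = {(p, p'). p \<in> J \<and> p' \<in> J \<and> fst p' \<subseteq> fst p}"
  have r: "trans r" "r \<subseteq> I \<times> I" "\<And>i. i \<in> I \<Longrightarrow> (i, i) \<in> r" and ne: "I \<noteq> {}"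
    and d: "\<And>i j. i \<in> I \<Longrightarrow> j \<in> I \<Longrightarrow> \<exists>k\<in>I. (i, k) \<in> r \<and> (j, k) \<in> r"
    using I by (auto simp: directed_set_def preorder_on_def refl_on_def)
  have uA: "u k \<in> A k" if "k \<in> I" for k
    using r that by (auto simp: A_def)
  have J: "(A k, u k) \<in> J" if "k \<in> I" for k
    using uA[OF that] that by (auto simp: J_def)
  have mono: "A k \<subseteq> A i" if "(i, k) \<in> r" for i k
    using that r(1) by (auto simp: A_def dest: transD)
  have dir: "directed_set J s"
    unfolding directed_set_def
  proof (intro conjI ballI)
    show "J \<noteq> {}" using ne J by blast
    show "preorder_on J s"
      by (auto simp: preorder_on_def refl_on_def trans_def s_def)
    fix p p' assume pp: "p \<in> J" "p' \<in> J"
    then obtain i j where ij: "i \<in> I" "j \<in> I" "fst p = A i" "fst p' = A j"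
      by (auto simp: J_def)
    with d obtain k where k: "k \<in> I" "(i, k) \<in> r" "(j, k) \<in> r" by blast
    show "\<exists>q\<in>J. (p, q) \<in> s \<and> (p', q) \<in> s"
      using J[OF k(1)] mono k ij pp by (intro bexI[of _ "(A k, u k)"]) (auto simp: s_def)
  qed
  have cau: "Cauchy_net X J s snd"
    unfolding Cauchy_net_def
  proof (intro conjI allI impI)
    have "A k \<subseteq> u ` I" for k using r(2) by (auto simp: A_def)
    moreover have "u ` I \<subseteq> topspace X" using u unfolding Cauchy_net_def by blast
    ultimately have *: "y \<in> topspace X" if "y \<in> A k" for k y using that by blast
    show "snd ` J \<subseteq> topspace X"
    proof
      fix y assume "y \<in> snd ` J"
      then obtain k where "y \<in> A k" unfolding J_def by auto
      then show "y \<in> topspace X" by (rule *)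
    qed
    fix U assume "openin X U \<and> 0 \<in> U"
    then have "\<exists>k\<in>I. \<forall>i j. (k, i) \<in> r \<and> (k, j) \<in> r \<longrightarrow> u i - u j \<in> U"
      using u by (simp add: Cauchy_net_def)
    then obtain k
      where k: "k \<in> I" and kr: "\<And>i j. (k, i) \<in> r \<Longrightarrow> (k, j) \<in> r \<Longrightarrow> u i - u j \<in> U"
      by auto
    have kU: "y - z \<in> U" if "y \<in> A k" "z \<in> A k" for y z
      using that kr by (auto simp: A_def)
    have "snd p \<in> A k" if "((A k, u k), p) \<in> s" for p
      using that by (auto simp: s_def J_def)
    with kU show "\<exists>m\<in>J. \<forall>p p'. (m, p) \<in> s \<and> (m, p') \<in> s \<longrightarrow> snd p - snd p' \<in> U"
      using J[OF k] by (intro bexI[of _ "(A k, u k)"]) auto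
  qed
  obtain l where l: "limitin X snd l (net_filter J s)"
    using X dir cau unfolding net_complete_def by blast
  have "limitin X u l (net_filter I r)"
    unfolding limitin_def
  proof (intro conjI allI impI)
    show "l \<in> topspace X" using l by (simp add: limitin_def)
    fix U assume "openin X U \<and> l \<in> U"
    then have "eventually (\<lambda>p. snd p \<in> U) (net_filter J s)"
      using l by (simp add: limitin_def)
    then obtain p where p: "p \<in> J" "\<And>p'. (p, p') \<in> s \<Longrightarrow> snd p' \<in> U"
      by (auto simp: eventually_net_filter[OF dir])
    then obtain k where k: "k \<in> I" "fst p = A k" by (auto simp: J_def)
    have "u j \<in> U" if "(k, j) \<in> r" for j
      using p(2)[of "(A k, u j)"] that k p(1) by (auto simp: s_def J_def A_def)
    then show "eventually (\<lambda>j. u j \<in> U) (net_filter I r)"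
      using k(1) by (auto simp: eventually_net_filter[OF I])
  qed
  then show ?thesis ..
qed


section \<open>Closed quadratic forms\<close>

text \<open>On \<^typ>\<open>ennreal\<close> we have \<open>0 * \<infinity> = 0\<close>.\<close>

definition quadratic_form :: "('a :: real_vector \<Rightarrow> ennreal) \<Rightarrow> bool" where
  "quadratic_form q \<longleftrightarrow>
     (\<forall>u v. 2 * q u + 2 * q v = q (u + v) + q (u - v)) \<and>
     (\<forall>c u. q (c *\<^sub>R u) = ennreal (\<bar>c\<bar>\<^sup>2) * q u)"

definition form_domain :: "('a \<Rightarrow> ennreal) \<Rightarrow> 'a set" where
  "form_domain q = {u. q u < \<infinity>}"

definition form_seminorm :: "('a \<Rightarrow> ennreal) \<Rightarrow> 'a \<Rightarrow> real" where
  "form_seminorm q u = sqrt (enn2real (q u))"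

definition form_seminorm_topology :: "('a :: real_vector \<Rightarrow> ennreal) \<Rightarrow> 'a topology" where
  "form_seminorm_topology q =
     topology_generated_by
       {{v \<in> form_domain q. form_seminorm q (v - u) < e} | u e. u \<in> form_domain q \<and> 0 < e}"

definition form_topology ::
  "'a :: real_vector topology \<Rightarrow> ('a \<Rightarrow> ennreal) \<Rightarrow> 'a topology" where
  "form_topology T q =
     topology_generated_by
       ({U. openin (subtopology T (form_domain q)) U} \<union> {U. openin (form_seminorm_topology q) U})"

definition closed_form :: "'a :: real_vector topology \<Rightarrow> ('a \<Rightarrow> ennreal) \<Rightarrow> bool" where
  "closed_form T q \<longleftrightarrow> net_complete (form_topology T q)"

end

theory Submission
  imports Defs
begin

text \<open>
  Let \<open>m\<close> be the supremum over the open neighbourhoods \<open>U\<close> of \<open>x\<close> of the infimum of \<open>q\<close> over \<open>U\<close>;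
  it is at most the limit inferior, so it suffices that \<open>q x \<le> m\<close>, and one may assume \<open>m < \<infinity>\<close>.
  Choose \<open>v\<close> in each neighbourhood with \<open>q v\<close> arbitrarily close to \<open>m\<close>. The midpoint of two such
  points is still close to \<open>x\<close>, so the value of \<open>q\<close> there is not much below \<open>m\<close>, and the
  parallelogram law makes these almost minimisers a Cauchy net for the form topology. No convexity of
  the neighbourhoods is needed. By completeness and the Hausdorff property the net converges to \<open>x\<close>
  in the form topology, whence \<open>q x \<le> m\<close>.
\<close>

section \<open>Quadratic forms\<close>

lemma quadratic_form_parallelogram:
  "quadratic_form q \<Longrightarrow> 2 * q u + 2 * q v = q (u + v) + q (u - v)"
  by (simp add: quadratic_form_def)

lemma quadratic_form_scale:
  "quadratic_form q \<Longrightarrow> q (c *\<^sub>R u) = ennreal (\<bar>c\<bar>\<^sup>2) * q u"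
  by (simp add: quadratic_form_def)

lemma zero_mem_form_domain:
  assumes "quadratic_form q"
  shows "0 \<in> form_domain q"
  \<comment> \<open>Scaling by 0 gives \<open>q 0 = 0 * q 0 = 0\<close>.\<close>
  using quadratic_form_scale[OF assms, of 0 0] by (simp add: form_domain_def)

lemma form_domain_scale:
  assumes "quadratic_form q" "u \<in> form_domain q"
  shows "c *\<^sub>R u \<in> form_domain q"
  using assms by (simp add: form_domain_def quadratic_form_scale ennreal_mult_less_top)

lemma form_domain_add_diff:
  assumes "quadratic_form q" "u \<in> form_domain q" "v \<in> form_domain q"
  shows "u + v \<in> form_domain q" "u - v \<in> form_domain q"
proof -
  have "q (u + v) + q (u - v) < \<infinity>"
    using assms by (simp add: form_domain_def ennreal_mult_less_top
        flip: quadratic_form_parallelogram)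
  then show "u + v \<in> form_domain q" "u - v \<in> form_domain q"
    by (simp_all add: form_domain_def)
qed

lemma enn2real_quadratic_form_scale:
  assumes "quadratic_form q"
  shows "enn2real (q (c *\<^sub>R u)) = c\<^sup>2 * enn2real (q u)"
  using assms by (simp add: quadratic_form_scale enn2real_mult)

text \<open>\<open>enn2real\<close> sends infinity to 0, so the law passes to the reals only where
  all four values are finite.\<close>

lemma enn2real_quadratic_form_parallelogram:
  assumes q: "quadratic_form q" and D: "u \<in> form_domain q" "v \<in> form_domain q"
  shows "enn2real (q (u + v)) + enn2real (q (u - v)) = 2 * enn2real (q u) + 2 * enn2real (q v)"
proof -
  have "enn2real (q (u + v) + q (u - v)) = enn2real (2 * q u + 2 * q v)"
    using quadratic_form_parallelogram[OF q] by simp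
  then show ?thesis
    using D form_domain_add_diff[OF q D]
    by (simp add: form_domain_def enn2real_plus enn2real_mult ennreal_mult_less_top)
qed

text \<open>Homogeneity turns \<open>q (u + v)\<close> into four times the value at the midpoint.
  Dropping the left side, which is nonnegative, gives midpoint convexity; keeping it shows that two
  almost minimisers are close once their midpoint is not much better.\<close>

lemma quadratic_form_midpoint:
  assumes q: "quadratic_form q" and D: "u \<in> form_domain q" "v \<in> form_domain q"
  shows "enn2real (q (u - v)) = 2 * enn2real (q u) + 2 * enn2real (q v)
           - 4 * enn2real (q ((1/2) *\<^sub>R (u + v)))"
  using enn2real_quadratic_form_parallelogram[OF assms]
  by (simp only: enn2real_quadratic_form_scale[OF q]) (simp add: power2_eq_square)

text \<open>The point with weight \<open>l / 2\<close> on \<open>b\<close> is the midpoint of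
  \<open>a\<close> and the point with weight \<open>l\<close> on \<open>b\<close>, so midpoint
  convexity drives the induction. Weights that are powers of 1/2 suffice later, where the weight
  only has to be small.\<close>

lemma quadratic_form_dyadic_convex:
  assumes q: "quadratic_form q" and D: "a \<in> form_domain q" "b \<in> form_domain q"
  shows "enn2real (q ((1 - (1/2)^n) *\<^sub>R a + (1/2)^n *\<^sub>R b))
           \<le> (1 - (1/2)^n) * enn2real (q a) + (1/2)^n * enn2real (q b)"
proof (induction n)
  case (Suc n)
  define l where "l = (1/2::real)^n"
  have l: "(1/2)^Suc n = l / 2"
    by (simp add: l_def)
  define c where "c = (1 - l) *\<^sub>R a + l *\<^sub>R b"
  define d where "d = (1/2) *\<^sub>R (a + c)"
  have c: "c \<in> form_domain q"
    unfolding c_def using D by (intro form_domain_add_diff form_domain_scale q)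
  have "a + c = (2 - l) *\<^sub>R a + l *\<^sub>R b"
    by (simp add: c_def algebra_simps scaleR_2)
  then have "d = ((2 - l) / 2) *\<^sub>R a + (l / 2) *\<^sub>R b"
    by (simp add: d_def scaleR_add_right)
  also have "(2 - l) / 2 = 1 - l / 2"
    by simp
  finally have "enn2real (q ((1 - l / 2) *\<^sub>R a + (l / 2) *\<^sub>R b)) = enn2real (q d)"
    by simp
  also have "\<dots> \<le> (enn2real (q a) + enn2real (q c)) / 2"
    using quadratic_form_midpoint[OF q D(1) c, folded d_def] enn2real_nonneg[of "q (a - c)"]
    by simp
  also have "\<dots> \<le> (enn2real (q a) + ((1 - l) * enn2real (q a) + l * enn2real (q b))) / 2"
    using Suc.IH unfolding l_def c_def by simp
  also have "\<dots> = (1 - l / 2) * enn2real (q a) + l / 2 * enn2real (q b)"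
    by (simp add: field_simps)
  finally show ?case unfolding l .
qed auto

text \<open>The dyadic convexity bound replaces the triangle inequality of the form seminorm.\<close>

lemma quadratic_form_uniform:
  assumes q: "quadratic_form q" and c: "0 \<le> c'" "c' < c"
  shows "\<exists>d>0. \<forall>a\<in>form_domain q. \<forall>b\<in>form_domain q.
           enn2real (q a) \<le> c' \<and> enn2real (q b) < d \<longrightarrow> enn2real (q (a + b)) < c"
proof -
  have "0 < 1 - c' / c"
    using c by simp
  then obtain n where n: "(1/2)^n < 1 - c' / c"
    using real_arch_pow_inv[of "1 - c' / c" "1/2"] by auto
  \<comment> \<open>The weight \<open>l\<close> is so small that \<open>c' / (1 - l) < c\<close>.
    The bound \<open>d\<close> is \<open>l\<close> times the remaining gap, so that
    \<open>c' / (1 - l) + d / l = c\<close>.\<close>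
  define l where "l = (1/2::real)^n"
  have l: "0 < l" "l < 1 - c' / c" "l < 1"
    using n c by (auto simp: l_def intro: less_le_trans)
  have lc: "c' < (1 - l) * c"
    using l c by (simp add: field_simps)
  define d where "d = l * (c - c' / (1 - l))"
  have d: "0 < d"
    using l lc by (simp add: d_def pos_divide_less_eq mult.commute)
  have "enn2real (q (a + b)) < c"
    if ab: "a \<in> form_domain q" "b \<in> form_domain q"
      and le: "enn2real (q a) \<le> c'" "enn2real (q b) < d" for a b
  proof -
    \<comment> \<open>Rescaling makes \<open>a + b\<close> a convex combination of \<open>a'\<close>
      and \<open>b'\<close> with weights \<open>1 - l\<close> and \<open>l\<close>. Each weight
      cancels one of the two factors produced by quadratic scaling.\<close>
    define a' b' where "a' = (1 / (1 - l)) *\<^sub>R a" and "b' = (1 / l) *\<^sub>R b"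
    have "a' \<in> form_domain q" "b' \<in> form_domain q"
      unfolding a'_def b'_def using ab form_domain_scale[OF q] by auto
    then have "enn2real (q ((1 - l) *\<^sub>R a' + l *\<^sub>R b'))
        \<le> (1 - l) * enn2real (q a') + l * enn2real (q b')"
      unfolding l_def by (rule quadratic_form_dyadic_convex[OF q])
    also have "(1 - l) *\<^sub>R a' + l *\<^sub>R b' = a + b"
      using l by (simp add: a'_def b'_def)
    also have "(1 - l) * enn2real (q a') + l * enn2real (q b')
        = enn2real (q a) / (1 - l) + enn2real (q b) / l"
      using l unfolding a'_def b'_def enn2real_quadratic_form_scale[OF q]
      by (simp add: power2_eq_square)
    also have "\<dots> < c' / (1 - l) + d / l"
      using l le by (intro add_le_less_mono divide_right_mono divide_strict_right_mono) auto
    also have "\<dots> = c"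
      using l by (simp add: d_def)
    finally show ?thesis .
  qed
  with d show ?thesis by blast
qed

lemma form_seminorm_less_iff:
  "0 < e \<Longrightarrow> form_seminorm q u < e \<longleftrightarrow> enn2real (q u) < e\<^sup>2"
  using real_sqrt_less_iff[of "enn2real (q u)" "e\<^sup>2"] by (simp add: form_seminorm_def)

section \<open>The form topology\<close>

text \<open>Induction over the generation of the topology leaves the case of a ball centred at some
  \<open>u\<close> other than \<open>y\<close>. There \<open>quadratic_form_uniform\<close> splits
  \<open>v - u\<close> into \<open>y - u\<close> and the small \<open>v - y\<close>. The radius
  \<open>e\<close> bounds \<open>q\<close> itself, not its square root.\<close>

lemma form_seminorm_topology_ball:
  assumes q: "quadratic_form q" and U: "openin (form_seminorm_topology q) U" and y: "y \<in> U"
    and yD: "y \<in> form_domain q"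
  shows "\<exists>e>0. \<forall>v\<in>form_domain q. enn2real (q (v - y)) < e \<longrightarrow> v \<in> U"
proof -
  have "generate_topology_on
      {{v \<in> form_domain q. form_seminorm q (v - u) < e} | u e. u \<in> form_domain q \<and> 0 < e} U"
    using U unfolding form_seminorm_topology_def openin_topology_generated_by_iff .
  then show ?thesis using y
  proof induction
    case (Int A B)
    then obtain e e' where
      "e > 0" "\<forall>v\<in>form_domain q. enn2real (q (v - y)) < e \<longrightarrow> v \<in> A"
      "e' > 0" "\<forall>v\<in>form_domain q. enn2real (q (v - y)) < e' \<longrightarrow> v \<in> B"
      by auto
    then show ?case by (intro exI[of _ "min e e'"]) auto
  next
    case (UN K)
    then show ?case by blast
  next
    case (Basis S)
    then obtain u e where S: "S = {v \<in> form_domain q. form_seminorm q (v - u) < e}"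
      and u: "u \<in> form_domain q" and e: "0 < e"
      by auto
    have "enn2real (q (y - u)) < e\<^sup>2"
      using Basis.prems e by (simp add: S form_seminorm_less_iff)
    from quadratic_form_uniform[OF q _ this] obtain d where "d > 0" and
      d: "\<And>a b. \<lbrakk>a \<in> form_domain q; b \<in> form_domain q; enn2real (q a) \<le> enn2real (q (y - u));
            enn2real (q b) < d\<rbrakk> \<Longrightarrow> enn2real (q (a + b)) < e\<^sup>2"
      by auto
    have "v \<in> S" if v: "v \<in> form_domain q" "enn2real (q (v - y)) < d" for v
      using d[of "y - u" "v - y"] form_domain_add_diff[OF q] v u yD e
      by (simp add: S form_seminorm_less_iff)
    with \<open>d > 0\<close> show ?case by blast
  qed auto
qed

text \<open>A \<open>T\<close>-open set cut with a \<open>q\<close>-ball about \<open>y\<close> is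
  the typical basic neighbourhood. Such sets survive finite intersections, so only the two kinds of
  generators remain; for the seminorm kind, \<open>W\<close> is the whole space.\<close>

lemma form_topology_ball:
  assumes q: "quadratic_form q" and U: "openin (form_topology T q) U" and y: "y \<in> U"
    and T: "topspace T = UNIV" and yD: "y \<in> form_domain q"
  shows "\<exists>W e. openin T W \<and> y \<in> W \<and> e > 0 \<and>
           (\<forall>v\<in>form_domain q. v \<in> W \<and> enn2real (q (v - y)) < e \<longrightarrow> v \<in> U)"
proof -
  have "generate_topology_on
      ({U. openin (subtopology T (form_domain q)) U} \<union> {U. openin (form_seminorm_topology q) U}) U"
    using U unfolding form_topology_def openin_topology_generated_by_iff .
  then show ?thesis using y
  proof induction
    case (Int A B)
    then obtain W e W' e' where
      "openin T W" "y \<in> W" "e > 0"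
      "\<forall>v\<in>form_domain q. v \<in> W \<and> enn2real (q (v - y)) < e \<longrightarrow> v \<in> A"
      "openin T W'" "y \<in> W'" "e' > 0"
      "\<forall>v\<in>form_domain q. v \<in> W' \<and> enn2real (q (v - y)) < e' \<longrightarrow> v \<in> B"
      by auto
    then show ?case by (intro exI[of _ "W \<inter> W'"] exI[of _ "min e e'"]) auto
  next
    case (UN K)
    then obtain k where k: "k \<in> K" "y \<in> k" by blast
    from UN.IH[OF this] obtain W e where
      "openin T W" "y \<in> W" "e > 0"
      "\<forall>v\<in>form_domain q. v \<in> W \<and> enn2real (q (v - y)) < e \<longrightarrow> v \<in> k"
      by blast
    with k(1) show ?case by blast
  next
    case (Basis S)
    then consider "openin (subtopology T (form_domain q)) S" | "openin (form_seminorm_topology q) S"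
      by blast
    then show ?case
    proof cases
      case 1
      then obtain W where "openin T W" "S = W \<inter> form_domain q"
        by (auto simp: openin_subtopology)
      with Basis.prems show ?thesis by (intro exI[of _ W] exI[of _ 1]) auto
    next
      case 2
      from form_seminorm_topology_ball[OF q 2 Basis.prems yD] openin_topspace[of T] show ?thesis
        unfolding T by blast
    qed
  qed auto
qed

lemma openin_form_topology_subtopology:
  "openin T U \<Longrightarrow> openin (form_topology T q) (U \<inter> form_domain q)"
  unfolding form_topology_def
  by (rule topology_generated_by_Basis) (auto simp: openin_subtopology)

lemma openin_form_topology_ball:
  "u \<in> form_domain q \<Longrightarrow> 0 < e \<Longrightarrow>
     openin (form_topology T q) {v \<in> form_domain q. form_seminorm q (v - u) < e}"
  unfolding form_topology_def form_seminorm_topology_def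
  by (intro topology_generated_by_Basis UnI2 CollectI) (auto intro!: topology_generated_by_Basis)

lemma topspace_form_topology:
  assumes T: "topspace T = UNIV"
  shows "topspace (form_topology T q) = form_domain q"
proof
  have "openin (form_topology T q) (topspace T \<inter> form_domain q)"
    by (rule openin_form_topology_subtopology) simp
  then show "form_domain q \<subseteq> topspace (form_topology T q)"
    using openin_subset T by fastforce
  have "U \<subseteq> form_domain q" if "openin (form_seminorm_topology q) U" for U
    using openin_subset[OF that]
    by (auto simp: form_seminorm_topology_def topology_generated_by_topspace)
  then show "topspace (form_topology T q) \<subseteq> form_domain q"
    by (auto simp: form_topology_def topology_generated_by_topspace openin_subtopology)
qed

section \<open>Almost minimisers near a point\<close>

text \<open>Intersecting the two sides of a product neighbourhood of \<open>(x, x)\<close> gives a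
  single \<open>V\<close>. This is applied to the difference and to the midpoint map.\<close>

lemma continuous_map_prod_diagonal:
  assumes h: "continuous_map (prod_topology T T) S h" and U: "openin S U" "h (x, x) \<in> U"
    and x: "x \<in> topspace T"
  shows "\<exists>V. openin T V \<and> x \<in> V \<and> (\<forall>a\<in>V. \<forall>b\<in>V. h (a, b) \<in> U)"
proof -
  define W where "W = {p \<in> topspace (prod_topology T T). h p \<in> U}"
  have W: "openin (prod_topology T T) W"
    unfolding W_def using h U(1) by (rule openin_continuous_map_preimage)
  have "(x, x) \<in> W"
    using U x by (simp add: W_def)
  from W[unfolded openin_prod_topology_alt, rule_format, OF this]
  obtain A B where "openin T A" "openin T B" "x \<in> A" "x \<in> B" "A \<times> B \<subseteq> W"
    by (elim exE conjE)
  moreover from this have "h (a, b) \<in> U" if "a \<in> A" "b \<in> B" for a b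
    using that by (auto simp: W_def)
  ultimately show ?thesis by (intro exI[of _ "A \<inter> B"]) auto
qed

lemma real_tvs_scaleR_continuous:
  assumes "real_tvs T"
  shows "continuous_map T T (\<lambda>u. c *\<^sub>R u)"
proof -
  have "continuous_map T (prod_topology euclideanreal T) (\<lambda>u. (c, u))"
    by (intro continuous_map_pairedI) auto
  from continuous_map_compose[OF this, of T "\<lambda>(c, u). c *\<^sub>R u"] assms show ?thesis
    by (simp add: real_tvs_def o_def)
qed

lemma real_tvs_linear_combination_continuous:
  assumes "real_tvs T"
  shows "continuous_map (prod_topology T T) T (\<lambda>p. c *\<^sub>R fst p + d *\<^sub>R snd p)"
proof -
  have "continuous_map (prod_topology T T) (prod_topology T T) (\<lambda>p. (c *\<^sub>R fst p, d *\<^sub>R snd p))"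
    using real_tvs_scaleR_continuous[OF assms]
    by (intro continuous_map_pairedI continuous_map_compose[unfolded o_def,
          OF continuous_map_fst] continuous_map_compose[unfolded o_def, OF continuous_map_snd])
  from continuous_map_compose[OF this, of T "\<lambda>(u, v). u + v"] assms show ?thesis
    by (simp add: real_tvs_def o_def)
qed

text \<open>The right side is the lower semicontinuous envelope of \<open>q\<close> at
  \<open>x\<close>, so this is lower semicontinuity stated without nets.\<close>

lemma closed_form_le_SUP_INF:
  fixes T :: "'a :: real_vector topology"
  assumes T: "real_tvs T" and q: "quadratic_form q" and cl: "closed_form T q"
  shows "q x \<le> (SUP U\<in>{U. openin T U \<and> x \<in> U}. INF v\<in>U. q v)"
proof (cases "(SUP U\<in>{U. openin T U \<and> x \<in> U}. INF v\<in>U. q v) = \<infinity>")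
  case False
  define N where "N = {U. openin T U \<and> x \<in> U}"
  define m where "m = (SUP U\<in>N. INF v\<in>U. q v)"
  have top: "topspace T = UNIV" and haus: "Hausdorff_space T"
    using T by (auto simp: real_tvs_def)
  have m: "m < \<infinity>"
    using False unfolding m_def N_def by (metis infinity_ennreal_def top.not_eq_extremum)
  have m_less: "m < m + ennreal e" if "0 < e" for e
    using ennreal_add_left_cancel_less[of m 0 "ennreal e"] m that by simp
  have UN: "UNIV \<in> N"
    using openin_topspace[of T] by (simp add: N_def top)
  \<comment> \<open>The error is added to the infimum rather than subtracted from \<open>m\<close>,
    which avoids truncated subtraction. A constant can be pulled out of the supremum because
    \<open>N\<close> is nonempty.\<close>
  have m_approx: "\<exists>U\<in>N. m < (INF v\<in>U. q v) + ennreal e" if "0 < e" for e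
  proof (rule ccontr)
    assume "\<not> ?thesis"
    then have "(SUP U\<in>N. (INF v\<in>U. q v) + ennreal e) \<le> m"
      by (intro SUP_least) (auto simp: not_less)
    moreover have "(SUP U\<in>N. (INF v\<in>U. q v) + ennreal e) = m + ennreal e"
      unfolding m_def using UN by (intro ennreal_SUP_add_left) auto
    moreover have "m < m + ennreal e"
      using m_less that .
    ultimately show False by simp
  qed
  have "\<exists>v\<in>V. q v < m + ennreal (inverse (Suc n))" if "V \<in> N" for V and n :: nat
  proof -
    have "(INF v\<in>V. q v) \<le> m"
      unfolding m_def using that by (rule SUP_upper)
    also have "m < m + ennreal (inverse (Suc n))"
      by (rule m_less) simp
    finally show ?thesis by (simp add: INF_less_iff)
  qed
  then obtain w where w: "\<And>V n. V \<in> N \<Longrightarrow> w V n \<in> V"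
    "\<And>V n. V \<in> N \<Longrightarrow> q (w V n) < m + ennreal (inverse (Suc n))"
    by metis
  define v where "v = (\<lambda>(V, n). w V n)"
  \<comment> \<open>An index pairs a neighbourhood, controlling closeness to \<open>x\<close>, with
    a number \<open>n\<close>, controlling the excess of \<open>q\<close> over
    \<open>m\<close>.\<close>
  define J where "J = N \<times> (UNIV :: nat set)"
  define s where "s = {(p, p'). p \<in> J \<and> p' \<in> J \<and> fst p' \<subseteq> fst p \<and> snd p \<le> snd p'}"
  have s_mem: "v p \<in> V" and s_less: "enn2real (q (v p)) < enn2real m + inverse (Suc n)"
    and s_dom: "v p \<in> form_domain q"
    if p_mem: "((V, n), p) \<in> s" for V n p
  proof -
    obtain V' n' where p: "p = (V', n')" "V' \<in> N" "V' \<subseteq> V" "n \<le> n'"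
      using p_mem by (cases p) (auto simp: s_def J_def)
    show "v p \<in> V"
      using w(1)[OF p(2), of n'] p by (auto simp: v_def)
    have "q (v p) < m + ennreal (inverse (Suc n'))"
      using w(2)[OF p(2)] p by (simp add: v_def)
    also have "\<dots> \<le> m + ennreal (inverse (Suc n))"
      using p by (intro add_left_mono ennreal_leI) (simp add: field_simps)
    also have "\<dots> = ennreal (enn2real m + inverse (Suc n))"
      using m by (simp add: ennreal_plus)
    finally have *: "q (v p) < ennreal (enn2real m + inverse (Suc n))" .
    also have "\<dots> < \<infinity>"
      by simp
    finally show vD: "v p \<in> form_domain q"
      by (simp add: form_domain_def)
    show "enn2real (q (v p)) < enn2real m + inverse (Suc n)"
      using vD by (intro iffD2[OF enn2real_less_iff] *) (simp add: form_domain_def)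
  qed
  have dir: "directed_set J s"
    unfolding directed_set_def
  proof (intro conjI ballI)
    show "J \<noteq> {}" using UN by (auto simp: J_def)
    show "preorder_on J s"
      by (auto simp: preorder_on_def refl_on_def trans_def s_def)
    fix p p' assume "p \<in> J" "p' \<in> J"
    then show "\<exists>k\<in>J. (p, k) \<in> s \<and> (p', k) \<in> s"
      by (intro bexI[of _ "(fst p \<inter> fst p', max (snd p) (snd p'))"]) (auto simp: s_def J_def N_def)
  qed
  have cau: "Cauchy_net (form_topology T q) J s v"
    unfolding Cauchy_net_def
  proof (intro conjI allI impI)
    have "(p, p) \<in> s" if "p \<in> J" for p
      using that by (simp add: s_def)
    then show "v ` J \<subseteq> topspace (form_topology T q)"
      using s_dom by (force simp: topspace_form_topology[OF top])
    fix U assume "openin (form_topology T q) U \<and> 0 \<in> U"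
    then obtain W e where W: "openin T W" "0 \<in> W" and e: "e > 0" and
      WU: "\<And>v. \<lbrakk>v \<in> form_domain q; v \<in> W; enn2real (q v) < e\<rbrakk> \<Longrightarrow> v \<in> U"
      using form_topology_ball[OF q _ _ top zero_mem_form_domain[OF q], of U] by auto
    obtain V where V: "openin T V" "x \<in> V" "\<And>a b. a \<in> V \<Longrightarrow> b \<in> V \<Longrightarrow> a - b \<in> W"
      using continuous_map_prod_diagonal[OF
          real_tvs_linear_combination_continuous[OF T, of 1 "-1"] W(1), of x] W(2) top
      by auto
    \<comment> \<open>The values at \<open>v i\<close> and \<open>v j\<close> exceed
      \<open>m\<close> by less than \<open>e / 8\<close>, and the value at their midpoint falls
      below \<open>m\<close> by less than \<open>e / 8\<close>. The midpoint identity has total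
      weight 4 on each side, so the sum of errors is below
      \<open>4 * e / 8 + 4 * e / 8 = e\<close>.\<close>
    obtain U1 where U1: "U1 \<in> N" "m < (INF v\<in>U1. q v) + ennreal (e / 8)"
      using m_approx[of "e / 8"] e by auto
    \<comment> \<open>As \<open>x\<close> is its own midpoint, continuity yields \<open>V1\<close>
      whose midpoints stay in \<open>U1\<close>.\<close>
    have "(1/2) *\<^sub>R x + (1/2) *\<^sub>R x \<in> U1"
      using U1(1) by (simp add: N_def flip: scaleR_add_left)
    then obtain V1 where V1: "openin T V1" "x \<in> V1"
      "\<And>a b. a \<in> V1 \<Longrightarrow> b \<in> V1 \<Longrightarrow> (1/2) *\<^sub>R (a + b) \<in> U1"
      using continuous_map_prod_diagonal[OF
          real_tvs_linear_combination_continuous[OF T, of "1/2" "1/2"], of U1 x] U1(1) top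
      by (auto simp: N_def scaleR_add_right)
    obtain n where n: "inverse (real (Suc n)) < e / 8"
      using reals_Archimedean[of "e / 8"] e by auto
    show "\<exists>k\<in>J. \<forall>i j. (k, i) \<in> s \<and> (k, j) \<in> s \<longrightarrow> v i - v j \<in> U"
    proof (intro bexI[of _ "(V \<inter> V1, n)"] allI impI)
      show "(V \<inter> V1, n) \<in> J" using V V1 by (auto simp: J_def N_def)
      fix i j assume ij: "((V \<inter> V1, n), i) \<in> s \<and> ((V \<inter> V1, n), j) \<in> s"
      then have iD: "v i \<in> form_domain q" and jD: "v j \<in> form_domain q"
        and i1: "v i \<in> V \<inter> V1" and j1: "v j \<in> V \<inter> V1"
        and "enn2real (q (v i)) < enn2real m + inverse (Suc n)"
          "enn2real (q (v j)) < enn2real m + inverse (Suc n)"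
        using s_dom s_mem s_less by blast+
      then have less: "enn2real (q (v i)) < enn2real m + e / 8"
        "enn2real (q (v j)) < enn2real m + e / 8"
        using n by linarith+
      define c where "c = (1/2) *\<^sub>R (v i + v j)"
      have cD: "c \<in> form_domain q"
        unfolding c_def using q iD jD by (intro form_domain_scale form_domain_add_diff)
      have "(INF v\<in>U1. q v) \<le> q c"
        unfolding c_def using V1(3) i1 j1 by (intro INF_lower) auto
      with U1(2) have "m < q c + ennreal (e / 8)"
        by (meson add_right_mono less_le_trans)
      also have "\<dots> = ennreal (enn2real (q c) + e / 8)"
        using cD e by (simp add: form_domain_def ennreal_plus)
      finally have "enn2real m < enn2real (q c) + e / 8"
        using m by (intro iffD2[OF enn2real_less_iff]) simp_all
      then have "enn2real (q (v i - v j)) < e"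
        using quadratic_form_midpoint[OF q iD jD, folded c_def] less by linarith
      then show "v i - v j \<in> U"
        using V(3) i1 j1 form_domain_add_diff(2)[OF q iD jD] by (intro WU) auto
    qed
  qed
  obtain l where l: "limitin (form_topology T q) v l (net_filter J s)"
    using net_complete_Cauchy_net[OF _ dir cau] cl by (auto simp: closed_form_def)
  have lD: "l \<in> form_domain q"
    using limitin_topspace[OF l] topspace_form_topology[OF top, of q] by simp
  have l_ev: "\<forall>\<^sub>F p in net_filter J s. v p \<in> W" if "openin (form_topology T q) W" "l \<in> W" for W
    using l that by (simp add: limitin_def)
  \<comment> \<open>On the form domain the form topology is finer than \<open>T\<close>, so the
    limit found by completeness is also a \<open>T\<close>-limit and can be compared with
    \<open>x\<close>.\<close>
  have "limitin T v l (net_filter J s)"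
    unfolding limitin_def
  proof (intro conjI allI impI)
    fix U assume "openin T U \<and> l \<in> U"
    then have "\<forall>\<^sub>F p in net_filter J s. v p \<in> U \<inter> form_domain q"
      using lD by (intro l_ev openin_form_topology_subtopology) auto
    then show "\<forall>\<^sub>F p in net_filter J s. v p \<in> U"
      by (rule eventually_mono) simp
  qed (simp add: top)
  moreover have "limitin T v x (net_filter J s)"
    unfolding limitin_def
  proof (intro conjI allI impI)
    fix U assume "openin T U \<and> x \<in> U"
    then have "(U, 0) \<in> J" by (simp add: J_def N_def)
    then show "\<forall>\<^sub>F p in net_filter J s. v p \<in> U"
      unfolding eventually_net_filter[OF dir] using s_mem by blast
  qed (simp add: top)
  moreover have "net_filter J s \<noteq> bot"
    using dir by (auto simp: trivial_limit_def eventually_net_filter[OF dir] directed_set_def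
        preorder_on_def refl_on_def)
  ultimately have lx: "l = x"
    using haus by (metis limitin_Hausdorff_unique)
  have "enn2real (q x) \<le> enn2real m"
  proof (rule ccontr)
    assume "\<not> ?thesis"
    \<comment> \<open>Far along the net \<open>q (v p)\<close> is at most \<open>c\<close>, while
      \<open>x - v p\<close> is small for \<open>q\<close>. The uniform estimate applied to their
      sum would give \<open>q x < q x\<close>.\<close>
    then obtain c where c: "enn2real m < c" "c < enn2real (q x)"
      using dense[of "enn2real m" "enn2real (q x)"] by auto
    have "0 \<le> c"
      using c(1) enn2real_nonneg[of m] by linarith
    from quadratic_form_uniform[OF q this c(2)] obtain d where d: "d > 0" and
      dD: "\<And>a b. \<lbrakk>a \<in> form_domain q; b \<in> form_domain q; enn2real (q a) \<le> c; enn2real (q b) < d\<rbrakk>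
          \<Longrightarrow> enn2real (q (a + b)) < enn2real (q x)"
      by auto
    obtain n where n: "inverse (real (Suc n)) < c - enn2real m"
      using reals_Archimedean[of "c - enn2real m"] c by auto
    let ?B = "{v \<in> form_domain q. form_seminorm q (v - x) < sqrt d}"
    have xD: "x \<in> form_domain q" and sd: "sqrt d > 0"
      using lD lx d by simp_all
    have "x \<in> ?B"
      using xD d quadratic_form_scale[OF q, of 0 0] by (simp add: form_seminorm_def)
    then have ev: "\<forall>\<^sub>F p in net_filter J s. v p \<in> ?B"
      using lx by (intro l_ev openin_form_topology_ball[OF xD sd]) simp
    have "(UNIV, n) \<in> J"
      using UN by (simp add: J_def)
    with dir have "\<forall>\<^sub>F p in net_filter J s. ((UNIV, n), p) \<in> s"
      unfolding eventually_net_filter[OF dir] by blast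
    with ev have "\<forall>\<^sub>F p in net_filter J s. v p \<in> ?B \<and> ((UNIV, n), p) \<in> s"
      by (rule eventually_conj)
    then obtain p where p: "v p \<in> ?B" "((UNIV, n), p) \<in> s"
      using \<open>net_filter J s \<noteq> bot\<close> eventually_happens' by blast
    have vD: "v p \<in> form_domain q" and "enn2real (q (v p - x)) < d"
      using p(1) sd d by (auto simp: form_seminorm_less_iff)
    moreover have "q (x - v p) = q (v p - x)"
      using quadratic_form_scale[OF q, of "-1" "v p - x"] by simp
    moreover have "enn2real (q (v p)) \<le> c"
      using s_less[OF p(2)] n by linarith
    ultimately have "enn2real (q (v p + (x - v p))) < enn2real (q x)"
      using form_domain_add_diff(2)[OF q xD vD] by (intro dD) auto
    then show False by simp
  qed
  \<comment> \<open>The comparison of real values carries over to \<open>ennreal\<close> only for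
    finite \<open>q x\<close>, since \<open>enn2real\<close> of infinity is 0. Finiteness comes from
    \<open>l = x\<close> lying in the form domain.\<close>
  moreover have "q x < \<infinity>"
    using lD lx by (simp add: form_domain_def)
  ultimately have "q x \<le> m"
    using m by (metis ennreal_enn2real ennreal_leI infinity_ennreal_def)
  then show ?thesis by (simp add: m_def N_def)
next
  case True
  show ?thesis unfolding True by simp
qed

theorem theorem1p35:
  fixes T :: "'a :: real_vector topology"
    and q :: "'a \<Rightarrow> ennreal"
    and I :: "'i set" and r :: "('i \<times> 'i) set"
    and u :: "'i \<Rightarrow> 'a" and x :: 'a
  assumes "real_tvs T"
    and "quadratic_form q"
    and "closed_form T q"
    and "directed_set I r"
    and "limitin T u x (net_filter I r)"
  shows "q x \<le> Liminf (net_filter I r) (\<lambda>i. q (u i))"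
proof -
  \<comment> \<open>A net converging to \<open>x\<close> eventually stays in \<open>U\<close>, so
    the infimum over \<open>U\<close> bounds its values from below.\<close>
  have "(INF v\<in>U. q v) \<le> Liminf (net_filter I r) (\<lambda>i. q (u i))" if "openin T U" "x \<in> U" for U
  proof (rule Liminf_bounded)
    have "\<forall>\<^sub>F i in net_filter I r. u i \<in> U"
      using assms(5) that by (simp add: limitin_def)
    then show "\<forall>\<^sub>F i in net_filter I r. (INF v\<in>U. q v) \<le> q (u i)"
      by (rule eventually_mono) (rule INF_lower)
  qed
  then have "(SUP U\<in>{U. openin T U \<and> x \<in> U}. INF v\<in>U. q v)
      \<le> Liminf (net_filter I r) (\<lambda>i. q (u i))"
    by (intro SUP_least) auto
  with closed_form_le_SUP_INF[OF assms(1-3)] show ?thesis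
    by (rule order_trans)
qed

end
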